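(* Let $q$ be an odd prime power and let $G$ be a graph with $k$ vertices. Then $i_P(G)\le\lceil\log_3\log_q((k-1)2^{k-2})\rceil$.
   Context: For a prime power $r\equiv1\pmod 4$, the Paley graph $P(r)$ has vertex set $\mathbb{F}_r$, with $u,v$ adjacent iff $u-v$ is a nonzero square in $\mathbb{F}_r$. For $n\ge1$ let $P_n=P((q^2)^{3^n})$, and $i_P(G)=\min\{n\ge1 : G\text{ is an induced subgraph of }P_n\}$.
   Formalization: The bound is proved as max(1, ⌈log_3 log_q((k-1)2^{k-2})⌉): since i_P(G) ≥ 1, the stated bound fails when the ceiling is ≤ 0 (e.g. q=5, k=3) and is undefined for k ≤ 2; in those cases i_P(G) = 1 is shown instead. *)

theory Defs
  imports
    Complex_Main
    "HOL-Library.Extended_Nat"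
    "HOL-Number_Theory.Prime_Powers"
    "HOL-Algebra.Ring"
    "Graph_Theory.Graph_Theory"
begin

text \<open>
  The field with \<open>r\<close> elements is unique up to isomorphism; we choose a representative whose
  elements are natural numbers. The choice is meaningful exactly when \<open>r\<close> is a prime power.
\<close>

definition finite_field :: "nat \<Rightarrow> nat ring" where
  "finite_field r = (SOME F. field F \<and> card (carrier F) = r)"

text \<open>
  Undirected simple graphs are symmetric loop-free digraphs without parallel arcs
  (locale \<^locale>\<open>pair_graph\<close>). The adjacency below is symmetric since \<open>-1\<close> is a square
  in the field with \<open>r\<close> elements whenever \<open>r\<close> is congruent to 1 modulo 4.
\<close>

definition paley_graph :: "nat \<Rightarrow> nat pair_pre_digraph" where
  "paley_graph r = (let F = finite_field r in
     \<lparr> pverts = carrier F,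
       parcs = {(u, v). u \<in> carrier F \<and> v \<in> carrier F \<and> u \<ominus>\<^bsub>F\<^esub> v \<noteq> \<zero>\<^bsub>F\<^esub> \<and>
                        (\<exists>y \<in> carrier F. u \<ominus>\<^bsub>F\<^esub> v = y \<otimes>\<^bsub>F\<^esub> y)} \<rparr>)"

definition paley_seq :: "nat \<Rightarrow> nat \<Rightarrow> nat pair_pre_digraph" where
  "paley_seq q n = paley_graph ((q ^ 2) ^ (3 ^ n))"

definition is_induced_subgraph_of :: "'a pair_pre_digraph \<Rightarrow> 'b pair_pre_digraph \<Rightarrow> bool" where
  "is_induced_subgraph_of G P \<longleftrightarrow>
     (\<exists>H. induced_subgraph H (with_proj P) \<and> digraph_iso (with_proj G) H)"

text \<open>
  The minimum is taken in \<^typ>\<open>enat\<close>, so it is \<open>\<infinity>\<close> if no \<open>n\<close> qualifies and every finite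
  upper bound includes the claim that the minimum exists.
\<close>

definition i_P :: "nat \<Rightarrow> 'a pair_pre_digraph \<Rightarrow> enat" where
  "i_P q G = (INF n \<in> {n. 1 \<le> n \<and> is_induced_subgraph_of G (paley_seq q n)}. enat n)"

end

theory Submission
  imports "HOL-Algebra.Algebraic_Closure" "HOL-Number_Theory.Residues" Defs
begin

text \<open>
  Put \<open>Q = q ^ 3 ^ N\<close>, so that the Paley graph in question has \<open>Q\<^sup>2\<close> vertices; the choice of \<open>N\<close>
  makes \<open>Q \<ge> 2 ^ k\<close>. No bound for general character sums (Weil) is needed, only the
  second moment of the quadratic character \<open>\<chi>\<close>: for distinct \<open>y\<close>, \<open>z\<close> the sum of
  \<open>\<chi> (x - y) * \<chi> (x - z)\<close> over all \<open>x\<close> is \<open>-1\<close>, hence the sum over \<open>x\<close> of the squared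
  deviations \<open>(\<Sum>y\<in>W. \<chi> (x - y))\<^sup>2\<close> is at most \<open>Q\<^sup>2 * card W\<close> for every set \<open>W\<close> of vertices.
  The vertices of \<open>G\<close> are embedded one after another while every vertex still to be embedded
  keeps a set of admissible images. By the second moment some admissible image of the next
  vertex splits all the other sets almost evenly, so each set is about halved in every step,
  and with \<open>m\<close> vertices left the sets still have at least \<open>(2 ^ m - m / 2 - 5 / 4) * Q\<close>
  elements.
\<close>

section \<open>Existence of finite fields\<close>

lemma (in cring) binomial_finsum:
  assumes x: "x \<in> carrier R" and y: "y \<in> carrier R"
  shows "(x \<oplus> y) [^] n = (\<Oplus>k\<in>{..n}. [(n choose k)] \<cdot> (x [^] k \<otimes> y [^] (n - k)))"
proof (induction n)
  case 0
  then show ?case by simp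
next
  case (Suc n)
  let ?a = "\<lambda>k. [(n choose k)] \<cdot> (x [^] k \<otimes> y [^] (Suc n - k))"
  let ?c = "\<lambda>k. [(n choose k)] \<cdot> (x [^] Suc k \<otimes> y [^] (n - k))"
  let ?d = "\<lambda>k. [(n choose Suc k)] \<cdot> (x [^] Suc k \<otimes> y [^] (n - k))"
  let ?b = "\<lambda>k. [(Suc n choose k)] \<cdot> (x [^] k \<otimes> y [^] (Suc n - k))"
  let ?s = "\<lambda>k. [(n choose k)] \<cdot> (x [^] k \<otimes> y [^] (n - k))"
  have sx: "?s k \<otimes> x = ?c k" for k
    using x y by (simp add: add_pow_ldistr add_pow_rdistr m_ac)
  have sy: "?s k \<otimes> y = ?a k" if "k \<le> n" for k
    using x y that by (simp add: add_pow_ldistr add_pow_rdistr m_ac Suc_diff_le)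
  have b: "?b (Suc k) = ?c k \<oplus> ?d k" for k
    using x y by (simp add: add.nat_pow_mult)
  have "(x \<oplus> y) [^] Suc n = (\<Oplus>k\<in>{..n}. ?s k) \<otimes> x \<oplus> (\<Oplus>k\<in>{..n}. ?s k) \<otimes> y"
    using Suc x y by (simp add: r_distr)
  also have "(\<Oplus>k\<in>{..n}. ?s k) \<otimes> x = (\<Oplus>k\<in>{..n}. ?c k)"
    using x y sx by (simp add: finsum_ldistr)
  also have "(\<Oplus>k\<in>{..n}. ?s k) \<otimes> y = (\<Oplus>k\<in>{..n}. ?a k)"
  proof -
    have "(\<Oplus>k\<in>{..n}. ?s k) \<otimes> y = (\<Oplus>k\<in>{..n}. ?s k \<otimes> y)"
      using x y by (intro finsum_ldistr) auto
    also have "\<dots> = (\<Oplus>k\<in>{..n}. ?a k)"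
      by (rule finsum_cong') (use x y sy in auto)
    finally show ?thesis .
  qed
  \<comment> \<open>The added term has coefficient \<open>n choose Suc n\<close>, which is zero. On
    the longer range the term for \<open>0\<close> splits off and the rest lines up with
    \<open>?c\<close>, ready for Pascal's rule.\<close>
  also have "(\<Oplus>k\<in>{..n}. ?a k) = (\<Oplus>k\<in>{..Suc n}. ?a k)"
    using x y by (simp add: binomial_eq_0)
  also have "\<dots> = (\<Oplus>k\<in>{..n}. ?d k) \<oplus> ?b 0"
    using x y by (subst finsum_Suc2) auto
  also have "(\<Oplus>k\<in>{..n}. ?c k) \<oplus> ((\<Oplus>k\<in>{..n}. ?d k) \<oplus> ?b 0)
      = (\<Oplus>k\<in>{..n}. ?c k \<oplus> ?d k) \<oplus> ?b 0"
    using x y by (subst finsum_addf) (auto simp: a_assoc)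
  also have "\<dots> = (\<Oplus>k\<in>{..n}. ?b (Suc k)) \<oplus> ?b 0"
    by (simp only: b)
  also have "\<dots> = (\<Oplus>k\<in>{..Suc n}. ?b k)"
    using x y by (subst finsum_Suc2) auto
  finally show ?case .
qed

text \<open>The prime \<open>p\<close> divides every binomial coefficient strictly between the two
  ends, so only the outermost terms of the expansion survive.\<close>

lemma (in cring) freshmans_dream:
  fixes p :: nat
  assumes "prime p" "[p] \<cdot> \<one> = \<zero>" and x: "x \<in> carrier R" and y: "y \<in> carrier R"
  shows "(x \<oplus> y) [^] p = x [^] p \<oplus> y [^] p"
proof -
  let ?b = "\<lambda>k. [(p choose k)] \<cdot> (x [^] k \<otimes> y [^] (p - k))"
  have vanish: "?b k = \<zero>" if k: "0 < k" "k < p" for k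
  proof -
    have z: "x [^] k \<otimes> y [^] (p - k) \<in> carrier R" using x y by simp
    obtain m where m: "p choose k = p * m"
      using dvd_choose_prime[of k p] k assms(1) by auto
    have pz: "[p] \<cdot> z = \<zero>" if "z \<in> carrier R" for z
      using add_pow_ldistr[of \<one> z p] that assms(2) by simp
    have "[(m * p)] \<cdot> (x [^] k \<otimes> y [^] (p - k)) = \<zero>"
      using add.nat_pow_pow[OF z, of p m] pz[of "[m] \<cdot> (x [^] k \<otimes> y [^] (p - k))"] z by simp
    then have "[(p * m)] \<cdot> (x [^] k \<otimes> y [^] (p - k)) = \<zero>"
      by (simp only: mult.commute)
    with m show ?thesis by simp
  qed
  \<comment> \<open>Since \<open>p \<ge> 2\<close>, the two outermost terms are distinct and can be
    split off at either end.\<close>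
  obtain n where n: "p = Suc (Suc n)"
    using le_Suc_ex[OF prime_ge_2_nat[OF assms(1)]] by auto
  have "(x \<oplus> y) [^] p = (\<Oplus>k\<in>{..Suc (Suc n)}. ?b k)"
    using binomial_finsum[OF x y, of p] unfolding n .
  also have "\<dots> = ?b p \<oplus> ((\<Oplus>k\<in>{..n}. ?b (Suc k)) \<oplus> ?b 0)"
    using x y by (subst finsum_Suc, force, subst finsum_Suc2, force) (simp add: n)
  also have "(\<Oplus>k\<in>{..n}. ?b (Suc k)) = (\<Oplus>k\<in>{..n}. \<zero>)"
  proof (rule finsum_cong')
    fix i assume "i \<in> {..n}"
    then show "?b (Suc i) = \<zero>" by (intro vanish) (simp_all add: n)
  qed auto
  finally show ?thesis using x y by simp
qed

lemma (in cring) freshmans_dream_power: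
  fixes p :: nat
  assumes "prime p" "[p] \<cdot> \<one> = \<zero>" and x: "x \<in> carrier R" and y: "y \<in> carrier R"
  shows "(x \<oplus> y) [^] (p ^ n) = x [^] (p ^ n) \<oplus> y [^] (p ^ n)"
proof (induction n)
  case (Suc n)
  have "(x \<oplus> y) [^] (p ^ Suc n) = ((x \<oplus> y) [^] (p ^ n)) [^] p"
    using x y by (simp add: nat_pow_pow mult.commute[of p])
  also have "\<dots> = x [^] (p ^ Suc n) \<oplus> y [^] (p ^ Suc n)"
    using Suc x y assms by (simp add: freshmans_dream nat_pow_pow mult.commute[of p])
  finally show ?case .
qed (use x y in simp)

section \<open>Fixed points of a Frobenius power in an algebraically closed field\<close>

lemma ring_hom_add_pow:
  fixes n :: nat
  assumes "ring_hom_ring R S h" "x \<in> carrier R"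
  shows "h ([n] \<cdot>\<^bsub>R\<^esub> x) = [n] \<cdot>\<^bsub>S\<^esub> h x"
proof -
  interpret ring_hom_ring R S h by fact
  show ?thesis by (induction n) (use assms(2) in auto)
qed

text \<open>The fixed points are the roots of \<open>X ^ r - X\<close> with
  \<open>r = p ^ n\<close>. This polynomial splits, so it has \<open>r\<close> roots with
  multiplicity, and the count of distinct roots is exact once every root is simple.\<close>

lemma (in algebraically_closed) card_frobenius_fixed:
  fixes p n :: nat
  assumes "prime p" "n > 0" and char: "[p] \<cdot> \<one> = \<zero>"
  shows "card {x \<in> carrier L. x [^] (p ^ n) = x} = p ^ n"
proof -
  define r where "r = p ^ n"
  have r2: "r \<ge> 2"
    using prime_ge_2_nat[OF assms(1)] \<open>n > 0\<close> self_le_power[of p n] unfolding r_def by linarith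
  let ?U = "poly_ring L"
  note sub = carrier_is_subring
  interpret UP: domain ?U by (rule univ_poly_is_domain[OF sub])
  have Xc: "X \<in> carrier ?U" by (rule var_closed(1)[OF sub])
  define P where "P = X [^]\<^bsub>?U\<^esub> r \<ominus>\<^bsub>?U\<^esub> X"
  have Pc: "P \<in> carrier ?U" unfolding P_def using Xc by simp
  have deg: "degree P = r"
  proof -
    have "degree (X [^]\<^bsub>?U\<^esub> r) = r"
      using polynomial_pow_degree[OF Xc, of r] by (simp add: var_def)
    moreover have "degree (\<ominus>\<^bsub>?U\<^esub> X) = 1"
      using univ_poly_a_inv_degree[OF sub Xc] by (simp add: var_def)
    moreover have "polynomial (carrier L) (X [^]\<^bsub>?U\<^esub> r)" "polynomial (carrier L) (\<ominus>\<^bsub>?U\<^esub> X)"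
      using Xc by (simp_all add: univ_poly_carrier)
    ultimately show ?thesis
      unfolding P_def a_minus_def univ_poly_add
      using poly_add_degree_eq[OF sub, of "X [^]\<^bsub>?U\<^esub> r" "\<ominus>\<^bsub>?U\<^esub> X"] r2 by simp
  qed
  then have Pne: "P \<noteq> []" using r2 by auto
  have evalP: "eval P x = x [^] r \<ominus> x" if x: "x \<in> carrier L" for x
  proof -
    interpret E: ring_hom_cring ?U L "\<lambda>p. eval p x" by (rule eval_cring_hom[OF sub x])
    have "eval (X [^]\<^bsub>?U\<^esub> r) x = x [^] r"
      using eval_monom[of \<one> x r] x unitary_monom_eq_var_pow[OF sub, of r] by simp
    then show ?thesis unfolding P_def using Xc x by (simp add: eval_var)
  qed
  have root: "is_root P x \<longleftrightarrow> x \<in> carrier L \<and> x [^] r = x" for x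
    using evalP Pne unfolding is_root_def by auto
  interpret C: ring_hom_ring L ?U poly_of_const
    using canonical_embedding_ring_hom[OF sub] by simp
  have charU: "[p] \<cdot>\<^bsub>?U\<^esub> \<one>\<^bsub>?U\<^esub> = \<zero>\<^bsub>?U\<^esub>"
    using ring_hom_add_pow[OF C.ring_hom_ring_axioms, of \<one> p] char by simp
  \<comment> \<open>A root \<open>a\<close> is simple since \<open>X ^ r - X = (X - a) ^ r - (X - a)\<close> in characteristic \<open>p\<close>.\<close>
  have simple: "alg_mult P a \<le> 1" for a
  proof (rule ccontr)
    assume "\<not> ?thesis"
    then have mult: "2 \<le> alg_mult P a" by simp
    then have a: "a \<in> carrier L" "a [^] r = a"
      using alg_mult_gt_zero_iff_is_root[OF Pc, of a] root[of a] by auto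
    define T where "T = [\<one>, \<ominus> a]"
    have Tc: "T \<in> carrier ?U" unfolding T_def
      using a by (simp add: univ_poly_carrier[symmetric] polynomial_def)
    have Tne: "T \<noteq> \<zero>\<^bsub>?U\<^esub>" unfolding T_def by (simp add: univ_poly_zero)
    obtain q where q: "q \<in> carrier ?U" "P = (T [^]\<^bsub>?U\<^esub> (2::nat)) \<otimes>\<^bsub>?U\<^esub> q"
      using le_alg_mult_imp_pdivides[OF a(1) Pc mult] unfolding T_def pdivides_def factor_def by blast
    define c where "c = poly_of_const a"
    have cc: "c \<in> carrier ?U" unfolding c_def using a(1) by simp
    have cr: "c [^]\<^bsub>?U\<^esub> r = c" unfolding c_def using a C.hom_nat_pow[of a r] by simp
    have XT: "X = T \<oplus>\<^bsub>?U\<^esub> c"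
      using a(1) unfolding T_def c_def univ_poly_add var_def poly_of_const_def by (simp add: l_neg)
    have "P = (T [^]\<^bsub>?U\<^esub> r \<oplus>\<^bsub>?U\<^esub> c) \<ominus>\<^bsub>?U\<^esub> (T \<oplus>\<^bsub>?U\<^esub> c)"
      unfolding P_def XT r_def UP.freshmans_dream_power[OF assms(1) charU Tc cc]
      using cr unfolding r_def by simp
    also have "\<dots> = T [^]\<^bsub>?U\<^esub> r \<ominus>\<^bsub>?U\<^esub> T"
      using Tc cc by (simp add: a_minus_def UP.minus_add UP.a_ac UP.r_neg UP.r_neg1 UP.r_neg2)
    finally have "P = T [^]\<^bsub>?U\<^esub> r \<ominus>\<^bsub>?U\<^esub> T" .
    \<comment> \<open>Cancelling one factor \<open>T\<close> between the two expressions for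
      \<open>P\<close> and evaluating at \<open>a\<close>, a root of \<open>T\<close>, gives
      \<open>0 = -1\<close>; the power \<open>T ^ (r - 1)\<close> vanishes at \<open>a\<close>
      because \<open>r \<ge> 2\<close>.\<close>
    moreover have "P = T \<otimes>\<^bsub>?U\<^esub> (T \<otimes>\<^bsub>?U\<^esub> q)"
      using q Tc by (simp add: numeral_2_eq_2 UP.m_assoc)
    moreover have "T [^]\<^bsub>?U\<^esub> r = T \<otimes>\<^bsub>?U\<^esub> T [^]\<^bsub>?U\<^esub> (r - 1)"
      using r2 Tc UP.nat_pow_Suc2[OF Tc, of "r - 1"] by simp
    ultimately have eq: "T \<otimes>\<^bsub>?U\<^esub> (T \<otimes>\<^bsub>?U\<^esub> q) = T \<otimes>\<^bsub>?U\<^esub> (T [^]\<^bsub>?U\<^esub> (r - 1) \<ominus>\<^bsub>?U\<^esub> \<one>\<^bsub>?U\<^esub>)"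
      using Tc by (simp add: a_minus_def UP.r_distr UP.r_minus)
    then have "T \<otimes>\<^bsub>?U\<^esub> q = T [^]\<^bsub>?U\<^esub> (r - 1) \<ominus>\<^bsub>?U\<^esub> \<one>\<^bsub>?U\<^esub>"
      using UP.m_lcancel[OF Tne Tc] Tc q(1) by simp
    then have "eval (T \<otimes>\<^bsub>?U\<^esub> q) a = eval (T [^]\<^bsub>?U\<^esub> (r - 1) \<ominus>\<^bsub>?U\<^esub> \<one>\<^bsub>?U\<^esub>) a" by simp
    moreover interpret E: ring_hom_cring ?U L "\<lambda>p. eval p a" by (rule eval_cring_hom[OF sub a(1)])
    have "eval T a = \<zero>" unfolding T_def using a(1) by (simp add: r_neg)
    moreover have "eval (T [^]\<^bsub>?U\<^esub> (r - 1)) a = \<zero>"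
    proof -
      have "r - 1 = Suc (r - 2)" using r2 by simp
      then have "T [^]\<^bsub>?U\<^esub> (r - 1) = T [^]\<^bsub>?U\<^esub> (r - 2) \<otimes>\<^bsub>?U\<^esub> T" by (simp only: UP.nat_pow_Suc)
      then show ?thesis using \<open>eval T a = \<zero>\<close> Tc by simp
    qed
    ultimately have "\<zero> = \<zero> \<ominus> \<one>"
      using Tc q(1) E.hom_sub E.hom_mult E.hom_one by simp
    then have "\<zero> = \<one>" using r_right_minus_eq[of \<zero> \<one>] by simp
    then show False by simp
  qed
  have "r = size (roots P)" using roots_over_carrier[OF Pc] deg unfolding splitted_def by simp
  also have "\<dots> = (\<Sum>x\<in>set_mset (roots P). count (roots P) x)"
    by (rule size_multiset_overloaded_eq)
  also have "\<dots> = (\<Sum>x\<in>set_mset (roots P). 1)"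
  proof (rule sum.cong[OF refl])
    fix x assume "x \<in># roots P"
    then have "count (roots P) x > 0" by simp
    then show "count (roots P) x = 1"
      using simple[of x] unfolding alg_mult_eq_count_roots[OF Pc] by linarith
  qed
  also have "set_mset (roots P) = {x \<in> carrier L. x [^] r = x}"
    using roots_mem_iff_is_root[OF Pc] root by auto
  finally show ?thesis unfolding r_def by simp
qed

text \<open>Closure under sums is the additivity of the Frobenius power, closure under products is
  commutativity; negatives and inverses follow by applying these to \<open>x + (-x) = 0\<close> and
  to \<open>x\<close> times \<open>inv x\<close>.\<close>

lemma (in algebraically_closed) field_frobenius_fixed:
  fixes p n :: nat
  assumes "prime p" and char: "[p] \<cdot> \<one> = \<zero>"
  shows "field (L \<lparr> carrier := {x \<in> carrier L. x [^] (p ^ n) = x} \<rparr>)"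
proof -
  let ?K = "{x \<in> carrier L. x [^] (p ^ n) = x}"
  have pos: "p ^ n > 0" using prime_gt_0_nat[OF assms(1)] by simp
  have "subring ?K L"
  proof (rule subringI)
    fix x assume "x \<in> ?K"
    then have x: "x \<in> carrier L" "x [^] (p ^ n) = x" by auto
    \<comment> \<open>Deducing the power of \<open>-x\<close> from that of the sum
      \<open>x + (-x)\<close> avoids a case split between \<open>p = 2\<close> and odd
      \<open>p\<close>.\<close>
    have "\<zero> [^] (p ^ n) = \<zero>" using pos by (simp add: nat_pow_zero)
    then have "x \<oplus> (\<ominus> x) [^] (p ^ n) = \<zero>"
      using freshmans_dream_power[OF assms, of x "\<ominus> x" n] x by (simp add: r_neg)
    then have "(\<ominus> x) [^] (p ^ n) = \<ominus> x"
      using x(1) by (metis a_inv_closed nat_pow_closed sum_zero_eq_neg a_comm)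
    then show "\<ominus> x \<in> ?K" using x by simp
  qed (auto simp: nat_pow_distrib freshmans_dream_power[OF assms])
  then have "subfield ?K L"
  proof (rule subfieldI')
    fix x assume "x \<in> ?K - {\<zero>}"
    then have x: "x \<in> carrier L" "x [^] (p ^ n) = x" "x \<noteq> \<zero>" by auto
    then have u: "x \<in> Units L" by (simp add: field_Units)
    have i: "inv x \<in> carrier L" "x \<otimes> inv x = \<one>" using u by auto
    have "x \<otimes> (inv x) [^] (p ^ n) = x \<otimes> inv x"
      using nat_pow_distrib[OF x(1) i(1), of "p ^ n"] unfolding i(2) x(2) by simp
    then have "(inv x) [^] (p ^ n) = inv x" using m_lcancel[OF x(3,1) nat_pow_closed[OF i(1)] i(1)] by simp
    then show "inv x \<in> ?K" using i by simp
  qed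
  then show ?thesis by (rule subfield_iff(2))
qed

section \<open>From an algebraic closure of the prime field to finite fields on the natural
  numbers\<close>

lemma exists_algebraically_closed_char_p:
  fixes p :: nat
  assumes "prime p"
  obtains L :: "((int list \<times> nat) multiset \<Rightarrow> int) ring"
  where "algebraically_closed L" "[p] \<cdot>\<^bsub>L\<^esub> \<one>\<^bsub>L\<^esub> = \<zero>\<^bsub>L\<^esub>"
proof -
  define R where "R = residue_ring (int p)"
  interpret residues_prime p R
    using assms by unfold_locales (simp_all add: R_def)
  interpret field R by (rule is_field)
  have pow: "[k] \<cdot>\<^bsub>R\<^esub> \<one>\<^bsub>R\<^esub> = int k mod int p" for k :: nat
    by (induction k) (simp_all add: res_zero_eq res_one_eq res_add_eq mod_simps add.commute)
  obtain L :: "((int list \<times> nat) multiset \<Rightarrow> int) ring"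
    where L: "algebraic_closure L (indexed_const ` carrier R)" "indexed_const \<in> ring_hom R L"
    by (rule exists_closure)
  interpret L: algebraic_closure L "indexed_const ` carrier R" by fact
  interpret h: ring_hom_ring R L indexed_const
    by (rule ring_hom_ringI2[OF ring_axioms L.ring_axioms L(2)])
  have "[p] \<cdot>\<^bsub>L\<^esub> \<one>\<^bsub>L\<^esub> = \<zero>\<^bsub>L\<^esub>"
    using ring_hom_add_pow[OF h.ring_hom_ring_axioms, of "\<one>\<^bsub>R\<^esub>" p] pow[of p] by (simp add: res_zero_eq[symmetric])
  with L.algebraically_closed_axioms show thesis using that by blast
qed

text \<open>The Frobenius-fixed subfield of the closure has the right order. Being finite, it is
  carried to the naturals by an injection, because \<open>finite_field\<close> chooses among rings
  of type \<open>nat ring\<close>.\<close>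

theorem exists_field_of_prime_power_order:
  fixes p n :: nat
  assumes "prime p" "n > 0"
  shows "\<exists>F :: nat ring. field F \<and> card (carrier F) = p ^ n"
proof -
  obtain L :: "((int list \<times> nat) multiset \<Rightarrow> int) ring"
    where L: "algebraically_closed L" "[p] \<cdot>\<^bsub>L\<^esub> \<one>\<^bsub>L\<^esub> = \<zero>\<^bsub>L\<^esub>"
    using exists_algebraically_closed_char_p[OF assms(1)] .
  interpret algebraically_closed L by fact
  let ?K = "{x \<in> carrier L. x [^]\<^bsub>L\<^esub> (p ^ n) = x}"
  have card: "card ?K = p ^ n" by (rule card_frobenius_fixed[OF assms L(2)])
  moreover have "p ^ n > 0" using prime_gt_0_nat[OF assms(1)] by simp
  ultimately have "finite ?K" by (intro card_ge_0_finite) simp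
  from finite_imp_inj_to_nat_seg[OF this] obtain f :: "_ \<Rightarrow> nat" where f: "inj_on f ?K"
    by (elim exE conjE)
  interpret K: field "L \<lparr> carrier := ?K \<rparr>" by (rule field_frobenius_fixed[OF assms(1) L(2)])
  have "field (image_ring f (L \<lparr> carrier := ?K \<rparr>))"
    by (rule K.inj_imp_image_ring_is_field) (use f in simp)
  moreover have "card (carrier (image_ring f (L \<lparr> carrier := ?K \<rparr>))) = p ^ n"
    using card_image[OF f] card by (simp add: image_ring_carrier)
  ultimately show ?thesis by blast
qed

section \<open>The quadratic character\<close>

text \<open>Over a finite field of odd order this is the quadratic character (the Legendre symbol
  for a prime field), real-valued so that its moments can be estimated directly.\<close>

definition (in ring) quad_char :: "'a \<Rightarrow> real" where
  "quad_char x = (if x = \<zero> then 0 else if \<exists>y\<in>carrier R. x = y \<otimes> y then 1 else -1)"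

locale odd_finite_field = field +
  assumes finite_carrier: "finite (carrier R)"
    and odd_order: "odd (card (carrier R))"
begin

lemma quad_char_zero [simp]: "quad_char \<zero> = 0"
  by (simp add: quad_char_def)

lemma quad_char_diff_self: "x \<in> carrier R \<Longrightarrow> quad_char (x \<ominus> x) = 0"
  by (simp add: quad_char_def)

lemma quad_char_values: "x \<noteq> \<zero> \<Longrightarrow> quad_char x = 1 \<or> quad_char x = -1"
  by (simp add: quad_char_def)

text \<open>The multiplicative group of a finite field is cyclic. The last clause encodes the order
  of \<open>g\<close>; as that order is even, it makes the parity of an exponent depend only on the
  element.\<close>

lemma exists_primitive_element:
  obtains g where "g \<in> carrier R" "g \<noteq> \<zero>"
    "\<And>x. x \<in> carrier R \<Longrightarrow> x \<noteq> \<zero> \<Longrightarrow> \<exists>i::nat. x = g [^] i"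
    "\<And>i j :: nat. g [^] i = g [^] j \<Longrightarrow> [i = j] (mod (card (carrier R) - 1))"
proof -
  interpret M: group "Multiplicative_Group.mult_of R" by (rule field_mult_group)
  obtain g where g: "g \<in> carrier (Multiplicative_Group.mult_of R)"
    and gen: "carrier (Multiplicative_Group.mult_of R) = {g [^] i | i::nat. i \<in> UNIV}"
    using finite_field_mult_group_has_gen[OF finite_carrier] by blast
  have "M.ord g = card (carrier R) - 1"
  proof -
    have "M.ord g = card (generate (Multiplicative_Group.mult_of R) {g})"
      by (rule M.generate_pow_card[OF g])
    also have "generate (Multiplicative_Group.mult_of R) {g} = carrier (Multiplicative_Group.mult_of R)"
      using M.generate_pow_on_finite_carrier[OF _ g] finite_carrier gen
      by (simp add: Multiplicative_Group.nat_pow_mult_of)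
    finally show ?thesis using finite_carrier by simp
  qed
  show ?thesis
  proof
    show "g \<in> carrier R" "g \<noteq> \<zero>" using g by auto
    show "\<exists>i::nat. x = g [^] i" if "x \<in> carrier R" "x \<noteq> \<zero>" for x
    proof -
      have "x \<in> carrier (Multiplicative_Group.mult_of R)" using that by simp
      then show ?thesis unfolding gen by blast
    qed
    show "[i = j] (mod (card (carrier R) - 1))" if "g [^] i = g [^] j" for i j :: nat
    proof -
      have "g [^]\<^bsub>Multiplicative_Group.mult_of R\<^esub> int i = g [^]\<^bsub>Multiplicative_Group.mult_of R\<^esub> int j"
        using that by (simp add: int_pow_int Multiplicative_Group.nat_pow_mult_of)
      then have "int (M.ord g) dvd int j - int i" using M.int_pow_eq[OF g] by blast
      then show ?thesis
        unfolding \<open>M.ord g = card (carrier R) - 1\<close>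
        by (metis cong_int_iff cong_iff_dvd_diff cong_sym)
    qed
  qed
qed

lemma even_order_minus_one: "even (card (carrier R) - 1)"
  using odd_order by simp

text \<open>The nonzero squares are exactly the even powers of a primitive element: a root
  \<open>g ^ j\<close> of \<open>g ^ i\<close> forces \<open>i = 2 * j\<close> modulo an even
  number.\<close>

lemma quad_char_primitive_power:
  assumes g: "g \<in> carrier R" "g \<noteq> \<zero>"
    and pw: "\<And>x. x \<in> carrier R \<Longrightarrow> x \<noteq> \<zero> \<Longrightarrow> \<exists>i::nat. x = g [^] i"
    and eq: "\<And>i j :: nat. g [^] i = g [^] j \<Longrightarrow> [i = j] (mod (card (carrier R) - 1))"
  shows "quad_char (g [^] (i::nat)) = (-1) ^ i"
proof -
  have nz: "g [^] n \<noteq> \<zero>" for n :: nat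
    using g by (induction n) (auto simp: integral_iff)
  have "(\<exists>y\<in>carrier R. g [^] i = y \<otimes> y) \<longleftrightarrow> even i"
  proof
    assume "\<exists>y\<in>carrier R. g [^] i = y \<otimes> y"
    then obtain y where y: "y \<in> carrier R" "g [^] i = y \<otimes> y" by blast
    then have "y \<noteq> \<zero>" using nz[of i] by auto
    then obtain j :: nat where "y = g [^] j" using pw y(1) by blast
    then have "g [^] i = g [^] (j + j)" using y g by (simp add: nat_pow_mult)
    then have "[i = j + j] (mod (card (carrier R) - 1))" by (rule eq)
    then have "[i = j + j] (mod 2)"
      using even_order_minus_one cong_dvd_modulus_nat by blast
    then show "even i" by (simp add: cong_def) presburger
  next
    assume "even i"
    then obtain j where "i = j + j" by (metis evenE mult_2)
    then show "\<exists>y\<in>carrier R. g [^] i = y \<otimes> y"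
      using g by (intro bexI[of _ "g [^] j"]) (auto simp: nat_pow_mult)
  qed
  then show ?thesis using nz[of i] by (simp add: quad_char_def)
qed

lemma quad_char_mult:
  assumes "x \<in> carrier R" "y \<in> carrier R"
  shows "quad_char (x \<otimes> y) = quad_char x * quad_char y"
proof (cases "x = \<zero> \<or> y = \<zero>")
  case True
  then show ?thesis using assms by auto
next
  case False
  obtain g where g: "g \<in> carrier R" "g \<noteq> \<zero>"
    "\<And>x. x \<in> carrier R \<Longrightarrow> x \<noteq> \<zero> \<Longrightarrow> \<exists>i::nat. x = g [^] i"
    "\<And>i j :: nat. g [^] i = g [^] j \<Longrightarrow> [i = j] (mod (card (carrier R) - 1))"
    using exists_primitive_element by blast
  obtain i j :: nat where "x = g [^] i" "y = g [^] j" using g(3) assms False by meson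
  then show ?thesis
    using quad_char_primitive_power[OF g] g(1) by (simp add: nat_pow_mult power_add)
qed

text \<open>Multiplication by the nonsquare \<open>g\<close> permutes the field and flips every
  sign, so the sum equals its own negative.\<close>

lemma sum_quad_char: "(\<Sum>x\<in>carrier R. quad_char x) = 0"
proof -
  obtain g where g: "g \<in> carrier R" "g \<noteq> \<zero>"
    "\<And>x. x \<in> carrier R \<Longrightarrow> x \<noteq> \<zero> \<Longrightarrow> \<exists>i::nat. x = g [^] i"
    "\<And>i j :: nat. g [^] i = g [^] j \<Longrightarrow> [i = j] (mod (card (carrier R) - 1))"
    using exists_primitive_element by blast
  have "quad_char g = -1" using quad_char_primitive_power[OF g, of 1] g(1) by simp
  have inj: "inj_on ((\<otimes>) g) (carrier R)"
    using g(1,2) by (auto intro!: inj_onI simp: m_lcancel)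
  have "(\<otimes>) g ` carrier R = carrier R"
    by (rule card_subset_eq[OF finite_carrier]) (use g(1) card_image[OF inj] in auto)
  then have "(\<Sum>x\<in>carrier R. quad_char x) = (\<Sum>x\<in>carrier R. quad_char (g \<otimes> x))"
    using sum.reindex[OF inj, of quad_char] by simp
  also have "\<dots> = (\<Sum>x\<in>carrier R. - quad_char x)"
    using \<open>quad_char g = -1\<close> g(1) by (intro sum.cong) (auto simp: quad_char_mult)
  finally show ?thesis by (simp add: sum_negf)
qed

lemma quad_char_one: "quad_char \<one> = 1"
  unfolding quad_char_def by (auto intro!: bexI[of _ \<one>])

lemma quad_char_square: "x \<noteq> \<zero> \<Longrightarrow> quad_char x * quad_char x = 1"
  using quad_char_values[of x] by auto

text \<open>For \<open>x \<noteq> 0\<close> the factor \<open>x\<close> can be pulled out of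
  \<open>x + d\<close>, and its character squares to 1, leaving the character of
  \<open>1 + d / x\<close>. This argument runs over everything except 1, so the full sum 0 loses the
  value 1 at 1.\<close>

lemma sum_quad_char_shift:
  assumes "d \<in> carrier R" "d \<noteq> \<zero>"
  shows "(\<Sum>x\<in>carrier R. quad_char x * quad_char (x \<oplus> d)) = -1"
proof -
  let ?h = "\<lambda>x. \<one> \<oplus> d \<otimes> inv x"
  have invc: "inv x \<in> carrier R" "x \<otimes> inv x = \<one>" if "x \<in> carrier R - {\<zero>}" for x
    using that field_Units by auto
  have summand: "quad_char x * quad_char (x \<oplus> d) = quad_char (?h x)" if x: "x \<in> carrier R - {\<zero>}" for x
  proof -
    have "x \<oplus> d = x \<otimes> (\<one> \<oplus> d \<otimes> inv x)"
    proof -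
      have "x \<otimes> (\<one> \<oplus> d \<otimes> inv x) = x \<oplus> d \<otimes> (x \<otimes> inv x)"
        using x invc(1)[OF x] assms(1) by (simp add: r_distr m_lcomm)
      then show ?thesis using invc(2)[OF x] assms(1) x by simp
    qed
    then have "quad_char (x \<oplus> d) = quad_char x * quad_char (?h x)"
      using quad_char_mult[of x "?h x"] x invc(1)[OF x] assms(1) by simp
    then show ?thesis using quad_char_square[of x] x by simp
  qed
  have inj: "inj_on ?h (carrier R - {\<zero>})"
  proof (rule inj_onI)
    fix x y assume x: "x \<in> carrier R - {\<zero>}" and y: "y \<in> carrier R - {\<zero>}" and eq: "?h x = ?h y"
    then have "d \<otimes> inv x = d \<otimes> inv y"
      using invc(1) assms(1) by simp
    then have "inv x = inv y" using invc(1)[OF x] invc(1)[OF y] assms by (simp add: m_lcancel)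
    then show "x = y" using x y by (metis field_Units Units_inv_inv)
  qed
  have sub: "?h ` (carrier R - {\<zero>}) \<subseteq> carrier R - {\<one>}"
  proof (rule image_subsetI)
    fix x assume x: "x \<in> carrier R - {\<zero>}"
    have "inv x \<noteq> \<zero>" using invc[OF x] x by auto
    then have "d \<otimes> inv x \<noteq> \<zero>" using assms invc(1)[OF x] by (simp add: integral_iff)
    then have "?h x \<noteq> \<one>" using assms(1) invc(1)[OF x] by simp
    then show "?h x \<in> carrier R - {\<one>}" using assms(1) invc(1)[OF x] by simp
  qed
  have img: "?h ` (carrier R - {\<zero>}) = carrier R - {\<one>}"
    by (rule card_subset_eq[OF _ sub]) (use finite_carrier card_image[OF inj] in auto)
  have "(\<Sum>x\<in>carrier R. quad_char x * quad_char (x \<oplus> d))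
      = (\<Sum>x\<in>carrier R - {\<zero>}. quad_char x * quad_char (x \<oplus> d))"
    by (subst sum.remove[OF finite_carrier zero_closed]) simp
  also have "\<dots> = (\<Sum>x\<in>carrier R - {\<zero>}. quad_char (?h x))"
    by (rule sum.cong[OF refl summand])
  also have "\<dots> = (\<Sum>x\<in>carrier R - {\<one>}. quad_char x)"
    using sum.reindex[OF inj, of quad_char] img by simp
  also have "\<dots> = (\<Sum>x\<in>carrier R. quad_char x) - quad_char \<one>"
    by (subst sum.remove[OF finite_carrier one_closed, of quad_char]) simp
  finally show ?thesis by (simp add: sum_quad_char quad_char_one)
qed

text \<open>Translating \<open>x\<close> by \<open>y\<close> reduces the sum to the shift
  \<open>d = y - z\<close>.\<close>

lemma quad_char_orthogonal:
  assumes "y \<in> carrier R" "z \<in> carrier R" "y \<noteq> z"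
  shows "(\<Sum>x\<in>carrier R. quad_char (x \<ominus> y) * quad_char (x \<ominus> z)) = -1"
proof -
  have inj: "inj_on (\<lambda>x. x \<oplus> y) (carrier R)"
    using assms(1) by (auto intro!: inj_onI)
  have img: "(\<lambda>x. x \<oplus> y) ` carrier R = carrier R"
    by (rule card_subset_eq[OF finite_carrier]) (use assms(1) card_image[OF inj] in auto)
  have "(\<Sum>x\<in>carrier R. quad_char (x \<ominus> y) * quad_char (x \<ominus> z))
      = (\<Sum>x\<in>carrier R. quad_char ((x \<oplus> y) \<ominus> y) * quad_char ((x \<oplus> y) \<ominus> z))"
    using sum.reindex[OF inj, of "\<lambda>x. quad_char (x \<ominus> y) * quad_char (x \<ominus> z)"] img by simp
  also have "\<dots> = (\<Sum>x\<in>carrier R. quad_char x * quad_char (x \<oplus> (y \<ominus> z)))"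
  proof (rule sum.cong[OF refl])
    fix x assume x: "x \<in> carrier R"
    have "(x \<oplus> y) \<ominus> y = x" "(x \<oplus> y) \<ominus> z = x \<oplus> (y \<ominus> z)"
      using x assms(1,2) by (simp_all add: a_minus_def a_assoc r_neg)
    then show "quad_char ((x \<oplus> y) \<ominus> y) * quad_char ((x \<oplus> y) \<ominus> z)
      = quad_char x * quad_char (x \<oplus> (y \<ominus> z))" by simp
  qed
  also have "\<dots> = -1"
    by (rule sum_quad_char_shift) (use assms in auto)
  finally show ?thesis .
qed

text \<open>It suffices that -1 is a square. If -1 is \<open>g ^ j\<close>, then
  \<open>g ^ (2 * j) = 1\<close>, so 4 divides \<open>2 * j\<close> and \<open>j\<close> is
  even.\<close>

lemma quad_char_minus_commute:
  assumes "[card (carrier R) = 1] (mod 4)" and "x \<in> carrier R" "y \<in> carrier R"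
  shows "quad_char (x \<ominus> y) = quad_char (y \<ominus> x)"
proof -
  obtain g where g: "g \<in> carrier R" "g \<noteq> \<zero>"
    "\<And>x. x \<in> carrier R \<Longrightarrow> x \<noteq> \<zero> \<Longrightarrow> \<exists>i::nat. x = g [^] i"
    "\<And>i j :: nat. g [^] i = g [^] j \<Longrightarrow> [i = j] (mod (card (carrier R) - 1))"
    using exists_primitive_element by blast
  have "\<ominus> \<one> \<noteq> \<zero>" by simp
  then obtain j :: nat where j: "\<ominus> \<one> = g [^] j" using g(3) by blast
  have "g [^] (j + j) = \<ominus> \<one> \<otimes> \<ominus> \<one>" using g(1) j by (simp add: nat_pow_mult)
  also have "\<dots> = g [^] (0::nat)" by (simp add: l_minus)
  finally have "[j + j = 0] (mod (card (carrier R) - 1))" by (rule g(4))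
  moreover have "4 dvd card (carrier R) - 1"
    using assms(1) odd_order by (simp add: cong_def) presburger
  ultimately have "[j + j = 0] (mod 4)" by (rule cong_dvd_modulus_nat)
  then have "even j" by (simp add: cong_def) presburger
  then have "quad_char (\<ominus> \<one>) = 1" unfolding j using quad_char_primitive_power[OF g, of j] by simp
  moreover have "x \<ominus> y = \<ominus> \<one> \<otimes> (y \<ominus> x)"
    using assms(2,3) by (simp add: l_minus a_minus_def minus_add a_comm)
  ultimately show ?thesis using quad_char_mult[of "\<ominus> \<one>" "y \<ominus> x"] assms(2,3) by simp
qed

end

section \<open>Prescribed sign patterns\<close>

text \<open>Expanding the square and summing over \<open>x\<close> first, each diagonal pair
  contributes at most \<open>card C\<close>, and every other pair at most 0 by
  orthogonality.\<close>

lemma sum_square_bilinear_le: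
  fixes \<chi> :: "'a \<Rightarrow> 'a \<Rightarrow> real"
  assumes "finite C" "W \<subseteq> C"
    and bound: "\<And>x y. \<lbrakk>x \<in> C; y \<in> C\<rbrakk> \<Longrightarrow> \<bar>\<chi> x y\<bar> \<le> 1"
    and orth: "\<And>y z. \<lbrakk>y \<in> C; z \<in> C; y \<noteq> z\<rbrakk> \<Longrightarrow> (\<Sum>x\<in>C. \<chi> x y * \<chi> x z) \<le> 0"
  shows "(\<Sum>x\<in>C. (\<Sum>y\<in>W. \<chi> x y)\<^sup>2) \<le> real (card C) * real (card W)"
proof -
  have fW: "finite W" using assms finite_subset by blast
  have "(\<Sum>x\<in>C. (\<Sum>y\<in>W. \<chi> x y)\<^sup>2) = (\<Sum>x\<in>C. \<Sum>y\<in>W. \<Sum>z\<in>W. \<chi> x y * \<chi> x z)"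
    by (simp add: power2_eq_square sum_product)
  also have "\<dots> = (\<Sum>y\<in>W. \<Sum>z\<in>W. \<Sum>x\<in>C. \<chi> x y * \<chi> x z)"
    by (subst sum.swap, rule sum.cong[OF refl], subst sum.swap, rule refl)
  also have "\<dots> \<le> (\<Sum>y\<in>W. \<Sum>z\<in>W. if z = y then real (card C) else 0)"
  proof (intro sum_mono)
    fix y z assume yz: "y \<in> W" "z \<in> W"
    show "(\<Sum>x\<in>C. \<chi> x y * \<chi> x z) \<le> (if z = y then real (card C) else 0)"
    proof (cases "z = y")
      case True
      have "(\<Sum>x\<in>C. \<chi> x y * \<chi> x y) \<le> (\<Sum>x\<in>C. 1)"
      proof (rule sum_mono)
        fix x assume "x \<in> C"
        with yz assms(2) have "\<bar>\<chi> x y\<bar> \<le> 1" by (intro bound) auto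
        then show "\<chi> x y * \<chi> x y \<le> 1"
          using abs_square_le_1[of "\<chi> x y"] by (simp add: power2_eq_square)
      qed
      with True show ?thesis by simp
    next
      case False
      then show ?thesis using orth[of y z] yz assms(2) by auto
    qed
  qed
  also have "\<dots> = real (card C) * real (card W)"
    using fW by simp
  finally show ?thesis .
qed

text \<open>An averaging argument. If every \<open>x\<close> in \<open>B\<close> were bad for some
  \<open>v\<close>, the squared relative deviations summed over \<open>V\<close> would exceed
  \<open>t\<^sup>2\<close> at each \<open>x\<close>, giving more than \<open>a * t\<^sup>2\<close>
  over \<open>B\<close>. The second moment over all of \<open>C\<close> allows at most
  \<open>card C / a\<close> for each \<open>v\<close>.\<close>

lemma exists_small_deviation:
  fixes \<chi> :: "'a \<Rightarrow> 'a \<Rightarrow> real" and A :: "'v \<Rightarrow> 'a set" and a t :: real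
  assumes "finite C"
    and bound: "\<And>x y. \<lbrakk>x \<in> C; y \<in> C\<rbrakk> \<Longrightarrow> \<bar>\<chi> x y\<bar> \<le> 1"
    and orth: "\<And>y z. \<lbrakk>y \<in> C; z \<in> C; y \<noteq> z\<rbrakk> \<Longrightarrow> (\<Sum>x\<in>C. \<chi> x y * \<chi> x z) \<le> 0"
    and "finite V" "B \<subseteq> C" "a > 0" "real (card B) \<ge> a"
    and A: "\<And>v. v \<in> V \<Longrightarrow> A v \<subseteq> C" "\<And>v. v \<in> V \<Longrightarrow> real (card (A v)) \<ge> a"
    and t: "t \<ge> 0" "t\<^sup>2 * a\<^sup>2 \<ge> real (card C) * real (card V)"
  shows "\<exists>x\<in>B. \<forall>v\<in>V. \<bar>\<Sum>y\<in>A v. \<chi> x y\<bar> \<le> t * real (card (A v))"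
proof (rule ccontr)
  assume "\<not> ?thesis"
  then have neg: "\<And>x. x \<in> B \<Longrightarrow> \<exists>v\<in>V. \<bar>\<Sum>y\<in>A v. \<chi> x y\<bar> > t * real (card (A v))"
    by (auto simp: not_le)
  define S where "S x v = ((\<Sum>y\<in>A v. \<chi> x y) / real (card (A v)))\<^sup>2" for x v
  have fB: "finite B" using assms finite_subset by blast
  have Bne: "B \<noteq> {}" using \<open>a > 0\<close> \<open>real (card B) \<ge> a\<close> by auto
  have pos: "real (card (A v)) > 0" if "v \<in> V" for v using A(2)[OF that] \<open>a > 0\<close> by linarith
  have "t\<^sup>2 < (\<Sum>v\<in>V. S x v)" if x: "x \<in> B" for x
  proof -
    obtain v where v: "v \<in> V" "\<bar>\<Sum>y\<in>A v. \<chi> x y\<bar> > t * real (card (A v))" using neg[OF x] by blast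
    then have "t < \<bar>(\<Sum>y\<in>A v. \<chi> x y) / real (card (A v))\<bar>"
      using pos[OF v(1)] by (simp add: field_simps)
    then have "t\<^sup>2 < S x v" unfolding S_def
      using t(1) by (metis power2_abs power_strict_mono zero_less_numeral)
    also have "\<dots> \<le> (\<Sum>v\<in>V. S x v)"
      by (rule member_le_sum) (use v \<open>finite V\<close> in \<open>auto simp: S_def\<close>)
    finally show ?thesis .
  qed
  then have "(\<Sum>x\<in>B. t\<^sup>2) < (\<Sum>x\<in>B. \<Sum>v\<in>V. S x v)"
    using fB Bne by (intro sum_strict_mono) auto
  also have "\<dots> = (\<Sum>v\<in>V. \<Sum>x\<in>B. S x v)" by (rule sum.swap)
  also have "\<dots> \<le> (\<Sum>v\<in>V. real (card C) / a)"
  proof (rule sum_mono)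
    fix v assume v: "v \<in> V"
    have "(\<Sum>x\<in>B. S x v) \<le> (\<Sum>x\<in>C. S x v)"
      by (rule sum_mono2) (use assms in \<open>auto simp: S_def\<close>)
    also have "\<dots> = (\<Sum>x\<in>C. (\<Sum>y\<in>A v. \<chi> x y)\<^sup>2) / (real (card (A v)))\<^sup>2"
      unfolding S_def power_divide by (rule sum_divide_distrib[symmetric])
    also have "\<dots> \<le> (real (card C) * real (card (A v))) / (real (card (A v)))\<^sup>2"
      by (intro divide_right_mono sum_square_bilinear_le) (use assms v in auto)
    also have "\<dots> = real (card C) / real (card (A v))" by (simp add: power2_eq_square)
    also have "\<dots> \<le> real (card C) / a"
      using A(2)[OF v] \<open>a > 0\<close> by (intro divide_left_mono) auto
    finally show "(\<Sum>x\<in>B. S x v) \<le> real (card C) / a" .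
  qed
  finally have "real (card B) * t\<^sup>2 < real (card V) * real (card C) / a" by simp
  moreover have "a * t\<^sup>2 \<le> real (card B) * t\<^sup>2"
    using \<open>real (card B) \<ge> a\<close> by (intro mult_right_mono) auto
  ultimately have "a * t\<^sup>2 < real (card V) * real (card C) / a" by linarith
  then have "t\<^sup>2 * a\<^sup>2 < real (card C) * real (card V)"
    using \<open>a > 0\<close> by (simp add: field_simps power2_eq_square)
  with t(2) show False by simp
qed

text \<open>For \<open>y \<noteq> x\<close> the number \<open>1 + \<epsilon> * \<chi> x y\<close> is
  2 on the sign class and 0 off it. At \<open>y = x\<close> it is 1 and must be removed, which costs
  the \<open>- 1\<close> in the bound.\<close>

lemma card_sign_class_ge:
  fixes \<chi> :: "'a \<Rightarrow> 'a \<Rightarrow> real"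
  assumes "finite W"
    and vals: "\<And>y. y \<in> W \<Longrightarrow> y \<noteq> x \<Longrightarrow> \<chi> x y = 1 \<or> \<chi> x y = -1" and "\<chi> x x = 0"
    and "\<epsilon> = 1 \<or> \<epsilon> = -1"
  shows "real (card {y \<in> W. \<chi> x y = \<epsilon>}) \<ge> (real (card W) - 1 - \<bar>\<Sum>y\<in>W. \<chi> x y\<bar>) / 2"
proof -
  have "real (card W) - 1 - \<bar>\<Sum>y\<in>W. \<chi> x y\<bar>
      \<le> real (card W) - (\<Sum>y\<in>W. if y = x then 1 else 0) + \<epsilon> * (\<Sum>y\<in>W. \<chi> x y)"
    using assms by auto
  also have "\<dots> = (\<Sum>y\<in>W. 1 - (if y = x then 1 else 0) + \<epsilon> * \<chi> x y)"
    by (simp add: sum.distrib sum_subtractf sum_distrib_left)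
  also have "\<dots> = (\<Sum>y\<in>W. if \<chi> x y = \<epsilon> then 2 else 0)"
  proof (rule sum.cong[OF refl])
    fix y assume "y \<in> W"
    with vals[of y] assms(3,4) show "1 - (if y = x then 1 else 0) + \<epsilon> * \<chi> x y = (if \<chi> x y = \<epsilon> then 2 else 0)"
      by (cases "y = x") auto
  qed
  also have "\<dots> = 2 * real (card {y \<in> W. \<chi> x y = \<epsilon>})"
    using assms(1) by (simp add: sum.If_cases Int_def)
  finally show ?thesis by simp
qed

text \<open>The coefficients \<open>c n = 2 ^ n - n / 2 - 5 / 4\<close> solve
  \<open>c (n + 1) = 2 * c n + (n + 1) / 2 + 1 / 4\<close>. The factor 2 pays for the halving,
  \<open>(n + 1) / 2\<close> for the deviation of the character sum, and \<open>1 / 4\<close> for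
  the loss of the chosen point, since \<open>Q / 4 \<ge> 1\<close>.\<close>

lemma exists_prescribed_signs:
  fixes \<chi> :: "'a \<Rightarrow> 'a \<Rightarrow> real" and A :: "'v \<Rightarrow> 'a set" and Q :: real and E :: "'v \<Rightarrow> 'v \<Rightarrow> bool"
  assumes "finite C" "real (card C) \<le> Q\<^sup>2" "Q \<ge> 4"
    and diag: "\<And>x. x \<in> C \<Longrightarrow> \<chi> x x = 0"
    and vals: "\<And>x y. \<lbrakk>x \<in> C; y \<in> C; x \<noteq> y\<rbrakk> \<Longrightarrow> \<chi> x y = 1 \<or> \<chi> x y = -1"
    and sym: "\<And>x y. \<lbrakk>x \<in> C; y \<in> C\<rbrakk> \<Longrightarrow> \<chi> x y = \<chi> y x"
    and orth: "\<And>y z. \<lbrakk>y \<in> C; z \<in> C; y \<noteq> z\<rbrakk> \<Longrightarrow> (\<Sum>x\<in>C. \<chi> x y * \<chi> x z) \<le> 0"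
    and E: "\<And>u v. E u v \<longleftrightarrow> E v u"
    and "finite U"
    and "\<And>u. u \<in> U \<Longrightarrow> A u \<subseteq> C"
    and "\<And>u. u \<in> U \<Longrightarrow> real (card (A u)) \<ge> (2 ^ card U - real (card U) / 2 - 5 / 4) * Q"
  shows "\<exists>f. (\<forall>u\<in>U. f u \<in> A u) \<and>
    (\<forall>u\<in>U. \<forall>v\<in>U. u \<noteq> v \<longrightarrow> \<chi> (f u) (f v) = (if E u v then 1 else -1))"
  using assms(9-)
proof (induction U arbitrary: A rule: finite_induct)
  case empty
  then show ?case by simp
next
  case (insert u U)
  define n where "n = card U"
  define a where "a = (2 ^ (n + 1) - real (n + 1) / 2 - 5 / 4) * Q"
  \<comment> \<open>The averaging needs \<open>t * a\<close> to be at least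
    \<open>sqrt n * Q\<close>; the root is replaced by the larger mean \<open>(n + 1) / 2\<close> of
    \<open>n\<close> and 1.\<close>
  define t where "t = real (n + 1) * Q / (2 * a)"
  have cardI: "card (insert u U) = n + 1" using insert by (simp add: n_def)
  \<comment> \<open>Equality holds at \<open>n = 0\<close>. Positivity ensures that even the last
    vertex still has a candidate.\<close>
  have c_ge: "(2::real) ^ (n + 1) - real (n + 1) / 2 - 5 / 4 \<ge> 1/4"
  proof -
    have "(2::real) ^ n \<ge> real n + 1" by (induction n) auto
    moreover have "(2::real) ^ (n + 1) - real (n + 1) / 2 - 5 / 4 = 2 * 2 ^ n - real n / 2 - 7 / 4"
      by (simp add: field_simps)
    ultimately show ?thesis using of_nat_0_le_iff[of n, where 'a = real] by linarith
  qed
  have "a > 0" unfolding a_def using c_ge \<open>Q \<ge> 4\<close> by (intro mult_pos_pos) auto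
  have sizes: "real (card (A v)) \<ge> a" if "v \<in> insert u U" for v
    using insert.prems(2)[OF that] unfolding a_def cardI .
  have bound: "\<bar>\<chi> x y\<bar> \<le> 1" if "x \<in> C" "y \<in> C" for x y
    using vals[OF that] diag that by (cases "x = y") auto
  have "\<exists>x\<in>A u. \<forall>v\<in>U. \<bar>\<Sum>y\<in>A v. \<chi> x y\<bar> \<le> t * real (card (A v))"
  proof (rule exists_small_deviation[OF assms(1) bound orth, where a = a])
    have "real (card C) * real n \<le> Q\<^sup>2 * real n"
      using assms(2) by (intro mult_right_mono) auto
    also have "\<dots> \<le> Q\<^sup>2 * (real (n + 1) / 2)\<^sup>2"
    proof (rule mult_left_mono)
      have "0 \<le> (real n - 1)\<^sup>2" by simp
      then show "real n \<le> (real (n + 1) / 2)\<^sup>2" by (simp add: power2_eq_square field_simps)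
    qed simp
    also have "\<dots> = t\<^sup>2 * a\<^sup>2"
      using \<open>a > 0\<close> unfolding t_def by (simp add: power2_eq_square field_simps)
    finally show "t\<^sup>2 * a\<^sup>2 \<ge> real (card C) * real (card U)" by (simp add: n_def)
    show "t \<ge> 0" unfolding t_def using \<open>a > 0\<close> \<open>Q \<ge> 4\<close> by simp
  qed (use insert.hyps insert.prems(1) sizes \<open>a > 0\<close> in auto)
  then obtain x where x: "x \<in> A u" "\<And>v. v \<in> U \<Longrightarrow> \<bar>\<Sum>y\<in>A v. \<chi> x y\<bar> \<le> t * real (card (A v))"
    by blast
  have xC: "x \<in> C" using x(1) insert.prems(1) by auto
  define A' where "A' v = {y \<in> A v. \<chi> x y = (if E u v then 1 else -1)}" for v
  have "real (card (A' v)) \<ge> (2 ^ card U - real (card U) / 2 - 5 / 4) * Q" if v: "v \<in> U" for v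
  proof -
    have Av: "A v \<subseteq> C" using insert.prems(1) v by auto
    \<comment> \<open>This leads to \<open>t \<le> 1\<close>, which lets
      \<open>(1 - t) * card (A v)\<close> be bounded below through \<open>a\<close>. For
      \<open>n = 0\<close> one would have \<open>t = 2\<close>, but here the vertex \<open>v\<close>
      is still to be placed.\<close>
    have "n \<ge> 1" using v insert.hyps by (simp add: n_def card_gt_0_iff Suc_le_eq) blast
    then have "2 * (2::real) ^ n \<ge> real n + 9 / 4"
      by (induction n rule: dec_induct) auto
    then have "(2::real) ^ (n + 1) - real (n + 1) / 2 - 5 / 4 \<ge> real (n + 1) / 2"
      by (simp add: field_simps)
    then have "real (n + 1) / 2 * Q \<le> a"
      unfolding a_def using \<open>Q \<ge> 4\<close> by (intro mult_right_mono) auto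
    then have "t \<le> 1"
      unfolding t_def using \<open>a > 0\<close> by (simp add: divide_le_eq)
    have "(2 ^ n - real n / 2 - 5 / 4) * Q = (2 ^ (n+1) - real (n + 1) / 2 - 5 / 4 - real (n + 1) / 2 - 1 / 4) * Q / 2"
      by (simp add: field_simps)
    also have "\<dots> = (a - real (n + 1) / 2 * Q - Q / 4) / 2"
      unfolding a_def by (simp add: algebra_simps)
    also have "\<dots> \<le> (a - real (n + 1) / 2 * Q - 1) / 2" using \<open>Q \<ge> 4\<close> by simp
    also have "\<dots> = ((1 - t) * a - 1) / 2"
      using \<open>a > 0\<close> unfolding t_def by (simp add: field_simps)
    also have "\<dots> \<le> ((1 - t) * real (card (A v)) - 1) / 2"
      using \<open>t \<le> 1\<close> sizes[of v] v by (intro divide_right_mono diff_right_mono mult_left_mono) auto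
    also have "\<dots> \<le> (real (card (A v)) - 1 - \<bar>\<Sum>y\<in>A v. \<chi> x y\<bar>) / 2"
      using x(2)[OF v] by (intro divide_right_mono) (simp_all add: algebra_simps)
    also have "\<dots> \<le> real (card (A' v))"
      unfolding A'_def
      by (rule card_sign_class_ge)
        (use Av xC diag vals \<open>finite C\<close> finite_subset in \<open>auto, blast\<close>)
    finally show ?thesis by (simp add: n_def)
  qed
  moreover have "A' v \<subseteq> C" if "v \<in> U" for v
    using that insert.prems(1) unfolding A'_def by blast
  ultimately obtain f where f: "\<And>v. v \<in> U \<Longrightarrow> f v \<in> A' v"
    "\<And>v w. \<lbrakk>v \<in> U; w \<in> U; v \<noteq> w\<rbrakk> \<Longrightarrow> \<chi> (f v) (f w) = (if E v w then 1 else -1)"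
    using insert.IH[of A'] by blast
  have fu: "\<chi> x (f v) = (if E u v then 1 else -1)" "f v \<in> A v" "f v \<in> C" if "v \<in> U" for v
    using f(1)[OF that] insert.prems(1)[of v] that unfolding A'_def by auto
  have neq: "v \<noteq> u" if "v \<in> U" for v using that insert.hyps by auto
  show ?case
  proof (intro exI[of _ "f(u := x)"] conjI ballI impI)
    fix v assume "v \<in> insert u U"
    then show "(f(u := x)) v \<in> A v" using x(1) fu(2) by auto
  next
    fix v w assume vw: "v \<in> insert u U" "w \<in> insert u U" "v \<noteq> w"
    consider "v = u" "w \<in> U" | "w = u" "v \<in> U" | "v \<in> U" "w \<in> U" using vw by auto
    then show "\<chi> ((f(u := x)) v) ((f(u := x)) w) = (if E v w then 1 else -1)"
    proof cases
      case 1 then show ?thesis using fu(1)[of w] neq by auto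
    next
      case 2 then show ?thesis using fu(1)[of v] sym[OF xC fu(3)[of v]] neq E[of u v] by auto
    next
      case 3 then show ?thesis using f(2) vw neq by auto
    qed
  qed
qed

section \<open>Embedding graphs into Paley graphs\<close>

text \<open>The witness \<open>H\<close> is the image of \<open>G\<close> under the isomorphism
  applying \<open>f\<close> to both ends of each arc; \<open>arcs\<close> then says that
  \<open>H\<close> carries every arc of \<open>P\<close> between its vertices.\<close>

lemma is_induced_subgraph_ofI:
  assumes wf: "pair_wf_digraph G" "pair_wf_digraph P"
    and inj: "inj_on f (pverts G)" and img: "f ` pverts G \<subseteq> pverts P"
    and arcs: "\<And>u v. \<lbrakk>u \<in> pverts G; v \<in> pverts G\<rbrakk> \<Longrightarrow> (u, v) \<in> parcs G \<longleftrightarrow> (f u, f v) \<in> parcs P"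
  shows "is_induced_subgraph_of G P"
proof -
  interpret G: pair_wf_digraph G by fact
  interpret P: pair_wf_digraph P by fact
  define h where "h = \<lparr>iso_verts = f, iso_arcs = map_prod f f, iso_head = snd, iso_tail = fst\<rparr>"
  define H where "H = app_iso h (with_proj G)"
  have sub: "parcs G \<subseteq> pverts G \<times> pverts G"
    using G.in_arcsD1 G.in_arcsD2 by auto
  have iso: "pre_digraph.digraph_isomorphism (with_proj G) h"
    unfolding pre_digraph.digraph_isomorphism_def
  proof (intro conjI)
    show "wf_digraph (with_proj G)" by (rule G.wf_digraph)
    show "inj_on (iso_arcs h) (arcs (with_proj G))"
      using inj_on_subset[OF map_prod_inj_on[OF inj inj] sub] by (simp add: h_def with_proj_def)
  qed (use inj in \<open>auto simp: h_def with_proj_def\<close>)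
  have H: "verts H = f ` pverts G" "arcs H = map_prod f f ` parcs G" "tail H = fst" "head H = snd"
    by (simp_all add: H_def app_iso_def h_def with_proj_def)
  have arcsH: "arcs H = {e \<in> parcs P. fst e \<in> f ` pverts G \<and> snd e \<in> f ` pverts G}"
    unfolding H using sub arcs by (force simp: image_iff)
  have "induced_subgraph H (with_proj P)"
    unfolding induced_subgraph_def subgraph_def compatible_def
  proof (intro conjI)
    show "wf_digraph H" unfolding wf_digraph_def H using sub by auto
    show "wf_digraph (with_proj P)" by (rule P.wf_digraph)
  qed (use img arcsH H in \<open>auto simp: with_proj_def\<close>)
  moreover have "digraph_iso (with_proj G) H"
    unfolding digraph_iso_def using iso H_def by blast
  ultimately show ?thesis unfolding is_induced_subgraph_of_def by blast
qed

lemma finite_field_prime_power: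
  fixes p n :: nat
  assumes "prime p" "n > 0"
  shows "field (finite_field (p ^ n))" "card (carrier (finite_field (p ^ n))) = p ^ n"
  using someI_ex[OF exists_field_of_prime_power_order[OF assms]]
  unfolding finite_field_def by blast+

text \<open>Adjacency in the Paley graph is the sign 1 of the character, so prescribing signs
  prescribes both edges and non-edges. Injectivity comes for free: distinct vertices get a nonzero
  sign, while the character of a zero difference is 0.\<close>

theorem induced_subgraph_of_paley_graph:
  fixes G :: "'a pair_pre_digraph" and Q :: nat
  assumes "primepow Q" "odd Q" "Q \<ge> 4" and "pair_graph G" and le: "2 ^ card (pverts G) \<le> Q"
  shows "is_induced_subgraph_of G (paley_graph (Q\<^sup>2))"
proof -
  interpret G: pair_graph G by fact
  define F where "F = finite_field (Q\<^sup>2)"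
  obtain p n where pn: "prime p" "n > 0" "Q = p ^ n"
    using \<open>primepow Q\<close> unfolding primepow_def by blast
  have "Q\<^sup>2 = p ^ (n * 2)" using pn by (simp add: power_mult)
  then have "field F" and cardF: "card (carrier F) = Q\<^sup>2"
    using finite_field_prime_power[of p "n * 2"] pn unfolding F_def by simp_all
  interpret field F by fact
  interpret odd_finite_field F
    using cardF \<open>odd Q\<close> \<open>Q \<ge> 4\<close> by unfold_locales (auto intro: card_ge_0_finite)
  have "[card (carrier F) = 1] (mod 4)"
  proof -
    obtain m where "Q = 2 * m + 1" using \<open>odd Q\<close> by (rule oddE)
    then have "Q\<^sup>2 = 1 + 4 * (m * m + m)" by (simp add: power2_eq_square algebra_simps)
    then show ?thesis unfolding cardF cong_def by simp
  qed
  note comm = quad_char_minus_commute[OF this]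
  have sym: "(u, v) \<in> parcs G \<longleftrightarrow> (v, u) \<in> parcs G" for u v
    using G.pair_sym_arcs by (auto simp: symmetric_def sym_def)
  let ?P = "paley_graph (Q\<^sup>2)"
  have "\<exists>f. (\<forall>u\<in>pverts G. f u \<in> carrier F) \<and> (\<forall>u\<in>pverts G. \<forall>v\<in>pverts G. u \<noteq> v \<longrightarrow>
      quad_char (f u \<ominus>\<^bsub>F\<^esub> f v) = (if (u, v) \<in> parcs G then 1 else -1))"
  proof (rule exists_prescribed_signs[where C = "carrier F" and Q = "real Q"])
    \<comment> \<open>Every vertex starts with the whole field as its candidate set, so
      \<open>2 ^ card (pverts G) * Q \<le> Q\<^sup>2\<close> is enough.\<close>
    show "(2 ^ card (pverts G) - real (card (pverts G)) / 2 - 5 / 4) * real Q \<le> real (card (carrier F))"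
    proof -
      have "(2 ^ card (pverts G) - real (card (pverts G)) / 2 - 5 / 4) \<le> (2 ^ card (pverts G) :: real)"
        by simp
      also have "\<dots> \<le> real Q" using le by (metis of_nat_le_iff of_nat_numeral of_nat_power)
      finally show ?thesis unfolding cardF by (simp add: power2_eq_square mult_right_mono)
    qed
  next
    fix y z assume "y \<in> carrier F" "z \<in> carrier F" "y \<noteq> z"
    then show "(\<Sum>x\<in>carrier F. quad_char (x \<ominus>\<^bsub>F\<^esub> y) * quad_char (x \<ominus>\<^bsub>F\<^esub> z)) \<le> 0"
      by (simp add: quad_char_orthogonal)
  next
    fix x y assume "x \<in> carrier F" "y \<in> carrier F" "x \<noteq> y"
    then show "quad_char (x \<ominus>\<^bsub>F\<^esub> y) = 1 \<or> quad_char (x \<ominus>\<^bsub>F\<^esub> y) = -1"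
      by (intro quad_char_values) simp
  qed (use finite_carrier quad_char_diff_self cardF \<open>Q \<ge> 4\<close> comm sym G.pair_finite_verts in auto)
  then obtain f where f: "\<And>u. u \<in> pverts G \<Longrightarrow> f u \<in> carrier F"
    "\<And>u v. \<lbrakk>u \<in> pverts G; v \<in> pverts G; u \<noteq> v\<rbrakk> \<Longrightarrow>
      quad_char (f u \<ominus>\<^bsub>F\<^esub> f v) = (if (u, v) \<in> parcs G then 1 else -1)"
    by blast
  have P: "pverts ?P = carrier F"
    "(x, y) \<in> parcs ?P \<longleftrightarrow> x \<in> carrier F \<and> y \<in> carrier F \<and> quad_char (x \<ominus>\<^bsub>F\<^esub> y) = 1" for x y
    unfolding paley_graph_def F_def[symmetric] Let_def quad_char_def by auto
  show ?thesis
  proof (rule is_induced_subgraph_ofI)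
    show "pair_wf_digraph ?P" by unfold_locales (auto simp: P)
    show "inj_on f (pverts G)"
    proof (rule inj_onI, rule ccontr)
      fix u v assume uv: "u \<in> pverts G" "v \<in> pverts G" "f u = f v" "u \<noteq> v"
      then have "quad_char (f u \<ominus>\<^bsub>F\<^esub> f v) = 0" using f(1) quad_char_diff_self by simp
      with f(2)[of u v] uv show False by (auto split: if_splits)
    qed
    show "f ` pverts G \<subseteq> pverts ?P" using f(1) P by auto
    fix u v assume uv: "u \<in> pverts G" "v \<in> pverts G"
    show "(u, v) \<in> parcs G \<longleftrightarrow> (f u, f v) \<in> parcs ?P"
    proof (cases "u = v")
      case True
      then show ?thesis using G.pair_no_loops[of "(u, v)"] f(1) uv quad_char_diff_self by (auto simp: P)
    next
      case False
      then show ?thesis using f uv by (auto simp: P split: if_splits)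
    qed
  qed (rule G.pair_wf_digraph_axioms)
qed

section \<open>From the iterated logarithm to a power bound, and the conclusion\<close>

lemma two_power_le_tower:
  fixes q k N :: nat
  assumes "q \<ge> 3" "N \<ge> 1"
    and N: "log 3 (log (real q) ((real k - 1) * 2 powr (real k - 2))) \<le> real N"
  shows "2 ^ k \<le> q ^ 3 ^ N"
proof (cases "k \<le> 4")
  case True
  \<comment> \<open>Small graphs are settled by \<open>16 \<le> 27\<close>. This includes
    \<open>k \<le> 2\<close>, where some \<open>log\<close> has an argument that is not
    positive.\<close>
  have "(2::nat) ^ k \<le> 2 ^ 4" using True by (intro power_increasing) auto
  also have "\<dots> \<le> 3 ^ 3 ^ 1" by simp
  also have "\<dots> \<le> q ^ 3 ^ 1" using assms by (intro power_mono) auto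
  also have "\<dots> \<le> q ^ 3 ^ N" using assms by (intro power_increasing) auto
  finally show ?thesis .
next
  case False
  define M where "M = (real k - 1) * 2 powr (real k - 2)"
  \<comment> \<open>From \<open>k = 5\<close> on, the factor \<open>k - 1\<close> in
    \<open>M\<close> is at least the 4 needed here.\<close>
  have "2 powr real k = 4 * 2 powr (real k - 2)" by (simp add: powr_diff)
  also have "\<dots> \<le> M" unfolding M_def using False by (intro mult_right_mono) auto
  finally have kM: "2 powr real k \<le> M" .
  have "1 < 2 powr real k" using False by (intro gr_one_powr) auto
  then have "M > 1" using kM by linarith
  then have "log (real q) M > 0" using assms by simp
  then have "log (real q) M \<le> 3 powr real N"
    using N unfolding M_def[symmetric] by (simp add: log_le_iff)
  then have "M \<le> real q powr (3 powr real N)"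
    using \<open>M > 1\<close> assms by (simp add: log_le_iff)
  also have "\<dots> = real (q ^ 3 ^ N)"
    using assms powr_realpow[of "real q" "3 ^ N"] by (simp add: powr_realpow)
  finally have "2 ^ k \<le> real (q ^ 3 ^ N)" using kM by (simp add: powr_realpow)
  then show ?thesis by (metis of_nat_le_iff of_nat_numeral of_nat_power)
qed

text \<open>The \<open>max 1\<close> reflects that \<open>i_P\<close> only ranges over
  \<open>n \<ge> 1\<close>, whereas the ceiling can be 0 or negative when \<open>q\<close> is large
  compared with \<open>k\<close>.\<close>

theorem theorem5p3:
  fixes q k :: nat and G :: "'a pair_pre_digraph"
  assumes "primepow q" and "odd q"
    and "pair_graph G" and "card (pverts G) = k"
  shows "i_P q G \<le>
    enat (max 1 (nat \<lceil>log 3 (log (real q) ((real k - 1) * 2 powr (real k - 2)))\<rceil>))"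
proof -
  define N where "N = max 1 (nat \<lceil>log 3 (log (real q) ((real k - 1) * 2 powr (real k - 2)))\<rceil>)"
  define Q where "Q = q ^ 3 ^ N"
  have "q > 1" using primepow_gt_Suc_0[OF assms(1)] by simp
  then have "q \<ge> 3" using \<open>odd q\<close> by (cases "q = 2") auto
  have "2 ^ k \<le> Q" unfolding Q_def
    by (rule two_power_le_tower[OF \<open>q \<ge> 3\<close>]) (unfold N_def, linarith+)
  \<comment> \<open>The bound \<open>N \<ge> 1\<close> enters here: it gives
    \<open>Q \<ge> 27\<close>, so that \<open>Q / 4\<close> can absorb the point lost in each
    embedding step.\<close>
  moreover have "Q \<ge> 4"
  proof -
    have "4 \<le> (3::nat) ^ 3 ^ 1" by simp
    also have "\<dots> \<le> q ^ 3 ^ 1" using \<open>q \<ge> 3\<close> by (intro power_mono) auto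
    also have "\<dots> \<le> Q" unfolding Q_def using \<open>q \<ge> 3\<close> by (intro power_increasing) (auto simp: N_def)
    finally show ?thesis .
  qed
  moreover have "primepow Q"
    using assms(1) \<open>q > 1\<close> unfolding Q_def by (simp add: primepow_power_iff_nat)
  moreover have "odd Q" using assms(2) unfolding Q_def by simp
  ultimately have "is_induced_subgraph_of G (paley_graph (Q\<^sup>2))"
    using assms(3,4) by (intro induced_subgraph_of_paley_graph) auto
  also have "paley_graph (Q\<^sup>2) = paley_seq q N"
    unfolding paley_seq_def Q_def by (simp add: power_mult[symmetric] mult.commute)
  finally have "N \<in> {n. 1 \<le> n \<and> is_induced_subgraph_of G (paley_seq q n)}"
    by (simp add: N_def)
  then have "i_P q G \<le> enat N" unfolding i_P_def by (rule INF_lower)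
  then show ?thesis unfolding N_def .
qed

end
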